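(* Let $N=N_1\circ N_2$ be a feedforward coalescence network. Then the set of eigenvalues of the Laplacian $L_N$ is the union of the sets of eigenvalues of $L_{N_1}$ and $L_{N_2}$. Moreover, let $\mu$ be an eigenvalue of $L_N$, and let $m_a(\mu)$, $m_a^i(\mu)$ ($i=1,2$) denote the algebraic multiplicity of $\mu$ for $L_N$ and $L_{N_i}$ respectively (equal to $0$ if $\mu$ is not an eigenvalue). Then: (i) if $\mu=0$, then $m_a(0)=m_a^1(0)+m_a^2(0)-1$; (ii) if $\mu\neq 0$, then $m_a(\mu)=m_a^1(\mu)+m_a^2(\mu)$.
   Context: A (weighted, uniform) network $N$ with $n$ cells consists of a finite set $C$ of cells and a real weighted adjacency matrix $W_N=(w_{ij})$, where $w_{ij}$ is the weight of the edge from cell $j$ to cell $i$ ($0$ if there is no edge; self-loops $w_{ii}$ are allowed). Networks are assumed connected as undirected graphs. The input valency of cell $i$ is $v(i)=\sum_j w_{ij}$, $D_N$ is the diagonal matrix of input valencies, and the Laplacian is $L_N=D_N-W_N$. Coalescence: $N=N_1\circ N_2$ has cell set $C=C_1\cup C_2$ with $C_1\cap C_2=\{c\}$, and weights $w^N_{cc}=w^{N_1}_{cc}+w^{N_2}_{cc}$; $w^N_{ab}=w^{N_i}_{ab}$ if $a,b\in C_i$ and $(a,b)\ne(c,c)$; all other weights are $0$. $N=N_1\circ N_2$ is a feedforward coalescence network (FFCN) if, in $N_2$, the coalescence cell $c$ receives no input edge from the other cells of $N_2$ (a self-loop at $c$ is allowed). *)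

theory Defs
  imports "Jordan_Normal_Form.Spectral_Radius" "Graph_Theory.Digraph_Component"
begin

text \<open>\<open>weight N i j\<close> is the weight of the edge from cell \<open>j\<close> to cell \<open>i\<close>; it is only
  meaningful for cells \<open>i\<close>, \<open>j\<close> of \<open>N\<close>, and nothing below depends on its other values.\<close>

record 'a network =
  cells :: "'a set"
  weight :: "'a \<Rightarrow> 'a \<Rightarrow> real"

definition network_digraph :: "'a network \<Rightarrow> ('a, 'a \<times> 'a) pre_digraph" where
  "network_digraph N =
     \<lparr> verts = cells N,
       arcs = {(j, i). j \<in> cells N \<and> i \<in> cells N \<and> weight N i j \<noteq> 0},
       tail = fst, head = snd \<rparr>"

definition is_network :: "'a network \<Rightarrow> bool" where
  "is_network N \<longleftrightarrow> finite (cells N) \<and> Digraph_Component.connected (network_digraph N)"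

definition valency :: "'a network \<Rightarrow> 'a \<Rightarrow> real" where
  "valency N i = (\<Sum>j\<in>cells N. weight N i j)"

text \<open>The matrices of a network are taken with respect to an ordering of its cells, given as a
  list that contains every cell exactly once.\<close>

definition cell_ordering :: "'a network \<Rightarrow> 'a list \<Rightarrow> bool" where
  "cell_ordering N xs \<longleftrightarrow> distinct xs \<and> set xs = cells N"

definition adjacency_mat :: "'a network \<Rightarrow> 'a list \<Rightarrow> real mat" where
  "adjacency_mat N xs = mat (length xs) (length xs) (\<lambda>(i, j). weight N (xs ! i) (xs ! j))"

definition valency_mat :: "'a network \<Rightarrow> 'a list \<Rightarrow> real mat" where
  "valency_mat N xs = mat_diag (length xs) (\<lambda>i. valency N (xs ! i))"

definition laplacian_mat :: "'a network \<Rightarrow> 'a list \<Rightarrow> real mat" where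
  "laplacian_mat N xs = valency_mat N xs - adjacency_mat N xs"

definition coalescence :: "'a \<Rightarrow> 'a network \<Rightarrow> 'a network \<Rightarrow> 'a network" where
  "coalescence c N1 N2 =
     \<lparr> cells = cells N1 \<union> cells N2,
       weight = (\<lambda>a b.
         if a = c \<and> b = c then weight N1 c c + weight N2 c c
         else if a \<in> cells N1 \<and> b \<in> cells N1 then weight N1 a b
         else if a \<in> cells N2 \<and> b \<in> cells N2 then weight N2 a b
         else 0) \<rparr>"

definition feedforward_coalescence :: "'a \<Rightarrow> 'a network \<Rightarrow> 'a network \<Rightarrow> bool" where
  "feedforward_coalescence c N1 N2 \<longleftrightarrow>
     is_network N1 \<and> is_network N2 \<and> cells N1 \<inter> cells N2 = {c} \<and>
     (\<forall>j\<in>cells N2 - {c}. weight N2 c j = 0)"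

text \<open>A real matrix need not have real eigenvalues, so eigenvalues and multiplicities are
  taken over the complex numbers.\<close>

definition complex_eigenvalues :: "real mat \<Rightarrow> complex set" where
  "complex_eigenvalues A = spectrum (map_mat complex_of_real A)"

definition alg_mult :: "real mat \<Rightarrow> complex \<Rightarrow> nat" where
  "alg_mult A \<mu> = order \<mu> (char_poly (map_mat complex_of_real A))"

end

theory Submission
  imports Defs
begin

text \<open>Order the cells of the coalescence with those of \<open>N1\<close> first. Its Laplacian is then block lower
  triangular with diagonal blocks \<open>L1\<close> and \<open>M\<close>, where \<open>M\<close> is \<open>L2\<close> with the row and column of \<open>c\<close>
  deleted: the self-loop of \<open>N2\<close> at \<open>c\<close> cancels between valency and weight. For the same reason the
  row of \<open>c\<close> in \<open>L2\<close> vanishes, so the characteristic polynomial of \<open>L2\<close> is \<open>X\<close> times that of \<open>M\<close>, and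
  multiplying the characteristic polynomial of \<open>L\<close> by \<open>X\<close> gives the product of those of \<open>L1\<close> and
  \<open>L2\<close>. The extra root \<open>0\<close> does not affect the set of roots, as \<open>L1\<close> has zero row sums.\<close>

text \<open>Entries depend on labels rather than positions, so a single \<open>f\<close> yields the
  matrix for every ordering or sublist of the cells, and block splitting becomes list
  append.\<close>

definition labelled_mat :: "'a list \<Rightarrow> 'b list \<Rightarrow> ('a \<Rightarrow> 'b \<Rightarrow> 'c) \<Rightarrow> 'c mat" where
  "labelled_mat xs ys f = mat (length xs) (length ys) (\<lambda>(i, j). f (xs ! i) (ys ! j))"

lemma labelled_mat_carrier [simp]: "labelled_mat xs ys f \<in> carrier_mat (length xs) (length ys)"
  by (simp add: labelled_mat_def)

lemma labelled_mat_dim [simp]: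
  "dim_row (labelled_mat xs ys f) = length xs" "dim_col (labelled_mat xs ys f) = length ys"
  by (simp_all add: labelled_mat_def)

lemma labelled_mat_index [simp]:
  "i < length xs \<Longrightarrow> j < length ys \<Longrightarrow> labelled_mat xs ys f $$ (i, j) = f (xs ! i) (ys ! j)"
  by (simp add: labelled_mat_def)

lemma labelled_mat_cong:
  assumes "\<And>a b. a \<in> set xs \<Longrightarrow> b \<in> set ys \<Longrightarrow> f a b = g a b"
  shows "labelled_mat xs ys f = labelled_mat xs ys g"
  using assms by (intro eq_matI) auto

lemma map_labelled_mat: "map_mat h (labelled_mat xs ys f) = labelled_mat xs ys (\<lambda>a b. h (f a b))"
  by (intro eq_matI) auto

lemma sum_nth_distinct:
  assumes "distinct xs"
  shows "(\<Sum>i = 0..<length xs. f (xs ! i)) = sum f (set xs)"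
  using sum.reindex_bij_betw[OF bij_betw_nth[OF assms refl refl], of f]
  by (simp add: atLeast0LessThan)

lemma labelled_mat_mult:
  fixes f :: "'a \<Rightarrow> 'b \<Rightarrow> 'c :: semiring_0"
  assumes "distinct ys"
  shows "labelled_mat xs ys f * labelled_mat ys zs g =
    labelled_mat xs zs (\<lambda>a b. \<Sum>y\<in>set ys. f a y * g y b)"
  by (intro eq_matI)
     (simp_all add: scalar_prod_def sum_nth_distinct[OF assms, of "\<lambda>y. f _ y * g y _"])

lemma labelled_mat_mult_vec:
  fixes f :: "'a \<Rightarrow> 'b \<Rightarrow> 'c :: semiring_0"
  assumes "distinct ys"
  shows "labelled_mat xs ys f *\<^sub>v vec (length ys) (\<lambda>j. g (ys ! j)) =
    vec (length xs) (\<lambda>i. \<Sum>y\<in>set ys. f (xs ! i) y * g y)"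
  by (intro eq_vecI)
     (simp_all add: scalar_prod_def sum_nth_distinct[OF assms, of "\<lambda>y. f _ y * g y"])

lemma labelled_mat_delta:
  assumes "distinct xs"
  shows "labelled_mat xs xs (\<lambda>a b. of_bool (a = b)) = (1\<^sub>m (length xs) :: 'c :: semiring_1 mat)"
  using assms by (intro eq_matI) (auto simp: nth_eq_iff_index_eq)

text \<open>Conjugation by a permutation matrix, namely the delta matrix between the two orderings.
  It frees the characteristic polynomial from the choice of ordering.\<close>

lemma similar_labelled_mat:
  fixes f :: "'a \<Rightarrow> 'a \<Rightarrow> 'c :: comm_ring_1"
  assumes "distinct xs" "distinct ys" "set xs = set ys"
  shows "similar_mat (labelled_mat xs xs f) (labelled_mat ys ys f)"
proof -
  have len: "length xs = length ys"
    using assms by (metis distinct_card)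
  define D where "D us vs = labelled_mat us vs (\<lambda>a b. of_bool (a = b) :: 'c)" for us vs :: "'a list"
  \<comment> \<open>In each sum over \<open>set vs\<close> only the term with equal labels survives,
    so \<open>D\<close> on the left relabels rows and, in \<open>mult_D\<close>, on the right
    relabels columns.\<close>
  have D_mult: "D us vs * labelled_mat vs ws g = labelled_mat us ws g"
    if "distinct vs" "set us = set vs" for us vs ws :: "'a list" and g :: "'a \<Rightarrow> 'a \<Rightarrow> 'c"
    unfolding D_def labelled_mat_mult[OF that(1)] using that(2)
    by (intro labelled_mat_cong) (simp add: of_bool_def if_distrib if_distribR cong: if_cong)
  have mult_D: "labelled_mat us vs g * D vs ws = labelled_mat us ws g"
    if "distinct vs" "set ws = set vs" for us vs ws :: "'a list" and g :: "'a \<Rightarrow> 'a \<Rightarrow> 'c"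
    unfolding D_def labelled_mat_mult[OF that(1)] using that(2)
    by (intro labelled_mat_cong) (simp add: of_bool_def if_distrib if_distribR cong: if_cong)
  show ?thesis
  proof (rule similar_matI)
    show "{labelled_mat xs xs f, labelled_mat ys ys f, D xs ys, D ys xs}
        \<subseteq> carrier_mat (length xs) (length xs)"
      using len unfolding D_def carrier_mat_def by simp
    have "D us vs * D vs us = 1\<^sub>m (length us)"
      if "distinct us" "distinct vs" "set us = set vs" for us vs :: "'a list"
      using D_mult[OF that(2,3)] labelled_mat_delta[OF that(1)] by (simp add: D_def)
    from this[OF assms] this[OF assms(2,1) assms(3)[symmetric]]
    show "D xs ys * D ys xs = 1\<^sub>m (length xs)" "D ys xs * D xs ys = 1\<^sub>m (length xs)"
      using len by simp_all
    show "labelled_mat xs xs f = D xs ys * labelled_mat ys ys f * D ys xs"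
      using D_mult[OF assms(2,3)] mult_D[OF assms(2,3)] by simp
  qed
qed

lemma char_poly_labelled_mat:
  "char_poly (labelled_mat xs xs f) =
    det ([:0, 1:] \<cdot>\<^sub>m 1\<^sub>m (length xs) + labelled_mat xs xs (\<lambda>a b. [:- f a b:]))"
  by (simp add: char_poly_defs map_labelled_mat)

text \<open>The hypothesis makes the upper right block of X I - A vanish, so its determinant is the
  product of those of the diagonal blocks.\<close>

lemma char_poly_labelled_mat_append:
  fixes f :: "'a \<Rightarrow> 'a \<Rightarrow> 'c :: idom"
  assumes "\<And>a b. a \<in> set xs \<Longrightarrow> b \<in> set ys \<Longrightarrow> f a b = 0"
  shows "char_poly (labelled_mat (xs @ ys) (xs @ ys) f) =
    char_poly (labelled_mat xs xs f) * char_poly (labelled_mat ys ys f)"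
proof -
  define C where "C zs = [:0, 1:] \<cdot>\<^sub>m 1\<^sub>m (length zs) + labelled_mat zs zs (\<lambda>a b. [:- f a b:])" for zs
  have "C (xs @ ys) = four_block_mat (C xs) (0\<^sub>m (length xs) (length ys))
      (labelled_mat ys xs (\<lambda>a b. [:- f a b:])) (C ys)"
    unfolding C_def by (intro eq_matI) (auto simp: nth_append assms)
  then have "det (C (xs @ ys)) = det (C xs) * det (C ys)"
    using det_four_block_mat_upper_right_zero[of "C xs" "length xs" _ "length ys" _ "C ys"]
    by (simp add: C_def)
  then show ?thesis
    by (simp add: char_poly_labelled_mat C_def)
qed

definition laplacian :: "'a network \<Rightarrow> 'a \<Rightarrow> 'a \<Rightarrow> complex" where
  "laplacian N a b = complex_of_real ((if a = b then valency N a else 0) - weight N a b)"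

lemma map_laplacian_mat:
  assumes "distinct xs"
  shows "map_mat complex_of_real (laplacian_mat N xs) = labelled_mat xs xs (laplacian N)"
  using assms
  by (intro eq_matI)
     (auto simp: laplacian_mat_def valency_mat_def adjacency_mat_def mat_diag_def laplacian_def
        nth_eq_iff_index_eq)

lemma laplacian_row_sum:
  assumes "finite (cells N)" "a \<in> cells N"
  shows "(\<Sum>b\<in>cells N. laplacian N a b) = 0"
  using assms by (simp add: laplacian_def valency_def sum_subtractf flip: of_real_sum)

lemma complex_eigenvalues_laplacian:
  assumes "distinct xs"
  shows "complex_eigenvalues (laplacian_mat N xs) =
    {\<mu>. poly (char_poly (labelled_mat xs xs (laplacian N))) \<mu> = 0}"
  unfolding complex_eigenvalues_def map_laplacian_mat[OF assms] spectrum_def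
  using eigenvalue_root_char_poly[OF labelled_mat_carrier] by blast

text \<open>The all-ones vector lies in the kernel because rows sum to zero; it is nonzero because
  there is at least one cell.\<close>

lemma zero_root_char_poly_laplacian:
  assumes "cell_ordering N xs" "cells N \<noteq> {}"
  shows "poly (char_poly (labelled_mat xs xs (laplacian N))) 0 = 0"
proof -
  have xs: "distinct xs" "set xs = cells N" and ne: "0 < length xs"
    using assms by (auto simp: cell_ordering_def)
  have fin: "finite (cells N)"
    by (simp flip: xs(2))
  let ?one = "vec (length xs) (\<lambda>_. 1 :: complex)"
  have "labelled_mat xs xs (laplacian N) *\<^sub>v ?one =
      vec (length xs) (\<lambda>i. \<Sum>b\<in>cells N. laplacian N (xs ! i) b)"
    using labelled_mat_mult_vec[OF xs(1), of xs "laplacian N" "\<lambda>_. 1"] by (simp add: xs(2))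
  also have "\<dots> = 0 \<cdot>\<^sub>v ?one"
    using laplacian_row_sum[OF fin] by (intro eq_vecI) (auto simp flip: xs(2))
  finally have "eigenvector (labelled_mat xs xs (laplacian N)) ?one 0"
    using ne by (auto simp: eigenvector_def dest: arg_cong[of _ _ "\<lambda>v. v $ 0"])
  then show ?thesis
    using eigenvalue_root_char_poly[OF labelled_mat_carrier] by (auto simp: eigenvalue_def)
qed

text \<open>A cell of \<open>N1\<close> other than \<open>c\<close> has no input from
  \<open>cells N2 - {c}\<close>, and neither has \<open>c\<close> by the feedforward condition. What
  \<open>N2\<close> adds is thus its self-loop at \<open>c\<close>.\<close>

lemma valency_coalescence_left:
  assumes "finite (cells N1)" "finite (cells N2)" "cells N1 \<inter> cells N2 = {c}"
    and "\<And>b. b \<in> cells N2 - {c} \<Longrightarrow> weight N2 c b = 0" and "a \<in> cells N1"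
  shows "valency (coalescence c N1 N2) a =
    valency N1 a + (if a = c then weight N2 c c else 0)"
proof -
  let ?w = "weight (coalescence c N1 N2)"
  have "cells N1 \<union> cells N2 = cells N1 \<union> (cells N2 - {c})" using assms(3) by auto
  then have "valency (coalescence c N1 N2) a =
      (\<Sum>b\<in>cells N1. ?w a b) + (\<Sum>b\<in>cells N2 - {c}. ?w a b)"
    unfolding valency_def using assms(1-3) by (subst sum.union_disjoint[symmetric])
      (auto simp: coalescence_def)
  also have "(\<Sum>b\<in>cells N2 - {c}. ?w a b) = 0"
  proof (rule sum.neutral, rule ballI)
    fix b assume b: "b \<in> cells N2 - {c}"
    then have "b \<notin> cells N1" "a \<in> cells N2 \<Longrightarrow> a = c"
      using assms(3,5) by blast+
    then show "?w a b = 0"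
      using assms(4)[OF b] b by (auto simp: coalescence_def)
  qed
  also have "(\<Sum>b\<in>cells N1. ?w a b) =
      (\<Sum>b\<in>cells N1. weight N1 a b + (if b = c then if a = c then weight N2 c c else 0 else 0))"
    using assms(5) by (intro sum.cong) (auto simp: coalescence_def)
  also have "\<dots> = valency N1 a + (if a = c then weight N2 c c else 0)"
    using assms(1,3) by (auto simp: sum.distrib valency_def)
  finally show ?thesis by simp
qed

lemma valency_coalescence_right:
  assumes "finite (cells N1)" "finite (cells N2)" "cells N1 \<inter> cells N2 = {c}"
    and "a \<in> cells N2 - {c}"
  shows "valency (coalescence c N1 N2) a = valency N2 a"
proof -
  have a: "a \<notin> cells N1" using assms(3,4) by blast
  have "valency (coalescence c N1 N2) a =
      (\<Sum>b\<in>cells N1 \<union> cells N2. if b \<in> cells N2 then weight N2 a b else 0)"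
    unfolding valency_def using a assms(4) by (intro sum.cong) (auto simp: coalescence_def)
  also have "\<dots> = (\<Sum>b\<in>cells N2. weight N2 a b)"
    using assms(1,2) by (intro sum.mono_neutral_cong_right) auto
  finally show ?thesis by (simp add: valency_def)
qed

text \<open>The common factor \<open>q\<close> belongs to the Laplacian of \<open>N2\<close> with
  the row and column of \<open>c\<close> deleted; naming it avoids a division by X.\<close>

lemma char_poly_laplacian_feedforward:
  assumes ff: "feedforward_coalescence c N1 N2"
    and ord: "cell_ordering N1 xs1" "cell_ordering N2 xs2"
      "cell_ordering (coalescence c N1 N2) xs"
  obtains q where
    "char_poly (labelled_mat xs xs (laplacian (coalescence c N1 N2))) =
      char_poly (labelled_mat xs1 xs1 (laplacian N1)) * q"
    "char_poly (labelled_mat xs2 xs2 (laplacian N2)) = [:0, 1:] * q"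
proof
  let ?N = "coalescence c N1 N2"
  have fin: "finite (cells N1)" "finite (cells N2)" and int: "cells N1 \<inter> cells N2 = {c}"
    and c0: "\<And>b. b \<in> cells N2 - {c} \<Longrightarrow> weight N2 c b = 0"
    using ff by (auto simp: feedforward_coalescence_def is_network_def)
  have xs: "distinct xs1" "set xs1 = cells N1" "distinct xs2" "set xs2 = cells N2"
    "distinct xs" "set xs = cells N1 \<union> cells N2"
    using ord by (auto simp: cell_ordering_def coalescence_def)
  \<comment> \<open>Dropping \<open>c\<close> makes \<open>xs1 @ ys\<close> list each cell of the
    coalescence exactly once.\<close>
  define ys where "ys = filter (\<lambda>a. a \<noteq> c) xs2"
  have ys: "distinct ys" "set ys = cells N2 - {c}"
    using xs by (auto simp: ys_def)
  let ?q = "char_poly (labelled_mat ys ys (laplacian N2))"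

  have "char_poly (labelled_mat xs xs (laplacian ?N)) =
      char_poly (labelled_mat (xs1 @ ys) (xs1 @ ys) (laplacian ?N))"
    using xs ys int by (intro char_poly_similar similar_labelled_mat) auto
  also have "\<dots> = char_poly (labelled_mat xs1 xs1 (laplacian ?N)) *
      char_poly (labelled_mat ys ys (laplacian ?N))"
  proof (rule char_poly_labelled_mat_append)
    \<comment> \<open>For \<open>a = c\<close> the weight is zero by the feedforward condition;
      otherwise \<open>a\<close> and \<open>b\<close> share no network. The lists are disjoint, so
      no valency enters.\<close>
    show "laplacian ?N a b = 0" if "a \<in> set xs1" "b \<in> set ys" for a b
      using that xs(2) ys(2) int c0 by (auto simp: laplacian_def coalescence_def)
  qed
  \<comment> \<open>At \<open>(c, c)\<close> both valency and weight grow by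
    \<open>weight N2 c c\<close>, which cancels.\<close>
  also have "labelled_mat xs1 xs1 (laplacian ?N) = labelled_mat xs1 xs1 (laplacian N1)"
    using valency_coalescence_left[OF fin int c0] xs(2)
    by (intro labelled_mat_cong) (auto simp: laplacian_def coalescence_def)
  also have "labelled_mat ys ys (laplacian ?N) = labelled_mat ys ys (laplacian N2)"
    using valency_coalescence_right[OF fin int] ys(2) int
    by (intro labelled_mat_cong) (auto simp: laplacian_def coalescence_def)
  finally show "char_poly (labelled_mat xs xs (laplacian ?N)) =
      char_poly (labelled_mat xs1 xs1 (laplacian N1)) * ?q" .

  have c: "c \<in> cells N2" using int by blast
  have "valency N2 c = weight N2 c c"
    unfolding valency_def using c c0 fin by (simp add: sum.remove)
  then have lap_c: "laplacian N2 c b = 0" if "b \<in> cells N2" for b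
    using that c0 by (auto simp: laplacian_def)
  \<comment> \<open>With \<open>c\<close> in front, its zero row supplies both the zero upper right
    block and a zero 1 by 1 diagonal block, whose characteristic polynomial is X.\<close>
  have "char_poly (labelled_mat xs2 xs2 (laplacian N2)) =
      char_poly (labelled_mat ([c] @ ys) ([c] @ ys) (laplacian N2))"
    using xs ys c by (intro char_poly_similar similar_labelled_mat) auto
  also have "\<dots> = char_poly (labelled_mat [c] [c] (laplacian N2)) * ?q"
    by (rule char_poly_labelled_mat_append) (use ys lap_c in auto)
  also have "char_poly (labelled_mat [c] [c] (laplacian N2)) = [:0, 1:]"
    unfolding char_poly_labelled_mat using lap_c[OF c] by (subst det_single) auto
  finally show "char_poly (labelled_mat xs2 xs2 (laplacian N2)) = [:0, 1:] * ?q" .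
qed

theorem proposition3p1:
  fixes N1 N2 N :: "'a network" and c :: 'a and xs1 xs2 xs :: "'a list"
  assumes "feedforward_coalescence c N1 N2"
    and "N = coalescence c N1 N2"
    and "cell_ordering N1 xs1" and "cell_ordering N2 xs2" and "cell_ordering N xs"
  defines "L1 \<equiv> laplacian_mat N1 xs1"
    and "L2 \<equiv> laplacian_mat N2 xs2"
    and "L \<equiv> laplacian_mat N xs"
  shows "complex_eigenvalues L = complex_eigenvalues L1 \<union> complex_eigenvalues L2 \<and>
    (\<forall>\<mu> \<in> complex_eigenvalues L.
      (\<mu> = 0 \<longrightarrow> int (alg_mult L 0) = int (alg_mult L1 0) + int (alg_mult L2 0) - 1) \<and>
      (\<mu> \<noteq> 0 \<longrightarrow> alg_mult L \<mu> = alg_mult L1 \<mu> + alg_mult L2 \<mu>))"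
proof -
  have dist: "distinct xs1" "distinct xs2" "distinct xs"
    using assms(3-5) by (auto simp: cell_ordering_def)
  define p p1 p2 where "p = char_poly (labelled_mat xs xs (laplacian N))"
    and "p1 = char_poly (labelled_mat xs1 xs1 (laplacian N1))"
    and "p2 = char_poly (labelled_mat xs2 xs2 (laplacian N2))"
  obtain q where p: "p = p1 * q" and p2: "p2 = [:0, 1:] * q"
    using char_poly_laplacian_feedforward[OF assms(1,3,4), of xs] assms(2,5)
    unfolding p_def p1_def p2_def by metis
  have ev: "complex_eigenvalues L = {\<mu>. poly p \<mu> = 0}" "complex_eigenvalues L1 = {\<mu>. poly p1 \<mu> = 0}"
    "complex_eigenvalues L2 = {\<mu>. poly p2 \<mu> = 0}"
    using dist unfolding L_def L1_def L2_def p_def p1_def p2_def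
    by (simp_all add: complex_eigenvalues_laplacian)
  have mult: "alg_mult L \<mu> = order \<mu> p" "alg_mult L1 \<mu> = order \<mu> p1" "alg_mult L2 \<mu> = order \<mu> p2" for \<mu>
    using dist unfolding L_def L1_def L2_def p_def p1_def p2_def alg_mult_def
    by (simp_all add: map_laplacian_mat)
  have "cells N1 \<noteq> {}"
    using assms(1) by (auto simp: feedforward_coalescence_def)
  then have p1_0: "poly p1 0 = 0"
    unfolding p1_def by (intro zero_root_char_poly_laplacian assms)
  \<comment> \<open>Characteristic polynomials are monic, hence nonzero, as additivity of
    \<open>order\<close> over products requires.\<close>
  have nz: "p \<noteq> 0" "p2 \<noteq> 0"
    using degree_monic_char_poly[OF labelled_mat_carrier] unfolding p_def p2_def
    by (metis coeff_0 zero_neq_one)+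
  have order_X: "order \<mu> [:0, 1 :: complex:] = (if \<mu> = 0 then 1 else 0)" for \<mu>
    using order_power_n_n[of 0 1] by (auto intro: order_0I)
  have "order \<mu> p = order \<mu> p1 + order \<mu> q" "order \<mu> p2 = order \<mu> [:0, 1:] + order \<mu> q" for \<mu>
    using order_mult nz unfolding p p2 by blast+
  \<comment> \<open>The roots of \<open>p2\<close> are those of \<open>q\<close> and 0, and 0 is
    already a root of \<open>p1\<close>, so the root sets agree. The factor X raises the order of
    \<open>p2\<close> over that of \<open>q\<close> by one at 0 and nowhere else, whence the
    correction by 1.\<close>
  then show ?thesis
    using p1_0 unfolding ev mult order_X by (auto simp: p p2)
qed

end
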